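(* Let $\kappa^->\kappa^+$ and let $\rho^-,\rho^+$ be given such that $0<\rho^-<\hat\rho<\rho^+<1$ and $f(\kappa^-,\rho^-)=f(\kappa^+,\rho^+)=:\bar f$. Then there exist infinitely many monotone functions $P:\mathbb{R}\to[0,1]$ (stationary profiles) satisfying $$P(x)\int_x^{x+h}\kappa(y)\,v(P(y))\,w(y-x)\,dy=\bar f\qquad\text{for all } x\in\mathbb{R}$$ and the boundary conditions $$\lim_{x\to-\infty}P(x)=\rho^-,\qquad\lim_{x\to+\infty}P(x)=\rho^+ .$$ At $x=0$ these profiles $P$ are continuous but not differentiable.
   Context: Fix $h>0$ and $\kappa^-,\kappa^+>0$, and let $\kappa(x)=\kappa^-$ for $x<0$ and $\kappa(x)=\kappa^+$ for $x>0$. The function $v\in C^2$ satisfies $v(0)=1$, $v(1)=0$, $v'(\rho)<0$ and $v''(\rho)\le 0$ for all $\rho\in[0,1]$. The weight $w\ge 0$ is defined on $x\ge0$, is continuous and bounded on $x>0$, and satisfies $\int_0^h w(x)\,dx=1$, $w(x)=0$ for all $x\ge h$, and $w'(x)<0$ for all $x\in(0,h)$. Put $f(\kappa,\rho)=\kappa\,\rho\,v(\rho)$. The number $\hat\rho\in(0,1)$ is the unique point (independent of $\kappa>0$) with $f_\rho(\kappa,\hat\rho)=0$, $f_\rho(\kappa,\rho)>0$ for $\rho<\hat\rho$ and $f_\rho(\kappa,\rho)<0$ for $\rho>\hat\rho$. A stationary profile $P$ is a stationary solution of the nonlocal conservation law $\rho_t+[\rho(t,x)\int_x^{x+h}\kappa(y)v(\rho(t,y))w(y-x)\,dy]_x=0$.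 *)

theory Defs
  imports "HOL-Analysis.Analysis"
begin

definition local_flux :: "(real \<Rightarrow> real) \<Rightarrow> real \<Rightarrow> real \<Rightarrow> real" where
  "local_flux v k \<rho> = k * \<rho> * v \<rho>"

text \<open>The values of \<open>\<kappa>\<close> and \<open>w\<close> at the single point \<open>0\<close> do not influence the integral, so
  \<open>\<kappa> 0\<close> may be arbitrary.\<close>

definition nonlocal_flux ::
  "(real \<Rightarrow> real) \<Rightarrow> (real \<Rightarrow> real) \<Rightarrow> (real \<Rightarrow> real) \<Rightarrow> real \<Rightarrow> (real \<Rightarrow> real) \<Rightarrow> real \<Rightarrow> real" where
  "nonlocal_flux \<kappa> v w h u x =
     u x * integral {x..x + h} (\<lambda>y. \<kappa> y * v (u y) * w (y - x))"

text \<open>The law \<open>\<rho>\<^sub>t + [\<dots>]\<^sub>x = 0\<close> is required at every point.  This does not require \<open>\<rho>\<close> itself to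
  be differentiable in \<open>x\<close>, only the flux.\<close>

definition solves_nonlocal_law ::
  "(real \<Rightarrow> real) \<Rightarrow> (real \<Rightarrow> real) \<Rightarrow> (real \<Rightarrow> real) \<Rightarrow> real \<Rightarrow> (real \<Rightarrow> real \<Rightarrow> real) \<Rightarrow> bool" where
  "solves_nonlocal_law \<kappa> v w h \<rho> \<longleftrightarrow>
     (\<forall>t x. \<exists>rt fx. ((\<lambda>s. \<rho> s x) has_real_derivative rt) (at t) \<and>
                   (nonlocal_flux \<kappa> v w h (\<rho> t) has_real_derivative fx) (at x) \<and>
                   rt + fx = 0)"

definition stationary_profile ::
  "(real \<Rightarrow> real) \<Rightarrow> (real \<Rightarrow> real) \<Rightarrow> (real \<Rightarrow> real) \<Rightarrow> real \<Rightarrow> (real \<Rightarrow> real) \<Rightarrow> bool" where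
  "stationary_profile \<kappa> v w h P \<longleftrightarrow> solves_nonlocal_law \<kappa> v w h (\<lambda>t. P)"

text \<open>The direction of monotonicity is left open; limits \<open>\<rho>m < \<rho>p\<close> force \<open>P\<close> to be nondecreasing.\<close>

definition connecting_profiles ::
  "(real \<Rightarrow> real) \<Rightarrow> (real \<Rightarrow> real) \<Rightarrow> (real \<Rightarrow> real) \<Rightarrow> real \<Rightarrow> real \<Rightarrow> real \<Rightarrow> real \<Rightarrow> (real \<Rightarrow> real) set" where
  "connecting_profiles \<kappa> v w h fbar \<rho>m \<rho>p =
     {P. (\<forall>x. P x \<in> {0..1}) \<and> (mono P \<or> antimono P) \<and>
         stationary_profile \<kappa> v w h P \<and>
         (\<forall>x. nonlocal_flux \<kappa> v w h P x = fbar) \<and>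
         (P \<longlongrightarrow> \<rho>m) at_bot \<and> (P \<longlongrightarrow> \<rho>p) at_top}"

end

theory Submission
  imports Defs
begin

text \<open>
Write \<open>A[P](x)\<close> for the integral of \<open>\<kappa>(x + s) v(P(x + s))\<close> against the weight, so that a profile
solves \<open>P A[P] = fbar\<close>.  Since \<open>v\<close> decreases, \<open>A\<close> reverses the pointwise order, hence
\<open>T P = fbar / A[P]\<close> preserves it; since \<open>\<kappa>\<close> drops at the origin, \<open>T\<close> also maps nondecreasing
functions to nondecreasing functions.  A monotone profile is therefore a Tarski fixed point: the
supremum of all nondecreasing subsolutions below a given supersolution
(\<open>monotone_solution_between\<close>).

The infinitely many profiles differ in their tails at \<open>+\<infinity>\<close>.  Linearising at \<open>\<rho>p\<close>, the deviation
\<open>\<eta> = \<rho>p - P\<close> satisfies \<open>\<eta>(x) = a \<integral> \<eta>(x + s) w(s) ds\<close> with \<open>a = - \<rho>p v'(\<rho>p) / v(\<rho>p)\<close>, and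
\<open>a > 1\<close> because \<open>\<rho>p\<close> lies on the falling branch of the flux.  So some \<open>exp(- l x)\<close> with \<open>l > 0\<close> is
a solution (\<open>decay_rate\<close>).  For \<open>x \<ge> 0\<close>, concavity of \<open>v\<close> makes \<open>\<rho>p - \<epsilon> exp(- l x)\<close> a subsolution,
while the quadratic error of the linearisation decays like \<open>exp(- 2 l x)\<close>, so that
\<open>\<rho>p - \<epsilon> (exp(- l x) - exp(- 2 l x))\<close> is a supersolution for small \<open>\<epsilon>\<close>.  To the left of the origin
the constants \<open>\<rho>m\<close> and \<open>\<rho>p\<close> serve as barriers.  A solution between the two remembers \<open>\<epsilon>\<close> as the
limit of \<open>exp(l x) (\<rho>p - P(x))\<close>, so different \<open>\<epsilon>\<close> give different profiles
(\<open>infinite_by_tail_coefficient\<close>).  At \<open>-\<infinity>\<close> the limit \<open>I\<close> of a profile satisfies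
\<open>\<kappa>m I v(I) \<le> fbar\<close>, and \<open>\<rho>m\<close> is the only such value in \<open>[\<rho>m, \<rho>p]\<close>
(\<open>connecting_profile_with_tail\<close>).

Every profile is \<open>fbar / A\<close>, and \<open>A\<close> is continuous as a convolution.  If \<open>P\<close> were differentiable at
the origin, so would be \<open>A\<close>, and \<open>A(t) - 2 A(0) + A(-t)\<close> would be \<open>o(t)\<close>.  But the drop of \<open>\<kappa>\<close>
contributes at least \<open>(\<kappa>m - \<kappa>p) v(P(0))\<close> times the integral of \<open>w\<close> over \<open>[0, t]\<close> to this second
difference, and the continuous variation of \<open>v \<circ> P\<close> removes only a vanishing fraction of that
integral, which itself is at least a positive multiple of \<open>t\<close>
(\<open>second_difference_lower_bound\<close>, \<open>profile_not_differentiable\<close>).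
\<close>

section \<open>Flux of exponential tails\<close>

text \<open>With \<open>r = \<rho>p\<close>, \<open>V = v \<rho>p\<close> and \<open>e = \<epsilon> exp(- l x)\<close>, the first-order terms of the flux of
\<open>\<rho>p - e\<close> cancel by the choice of the decay rate \<open>l\<close>, and what remains is \<open>- V e\<^sup>2 / r\<close>.\<close>

lemma subsolution_flux:
  fixes V r e :: real
  assumes "0 < V" "0 < r"
  shows "(r - e) * (V + V / r * e) \<le> r * V"
proof -
  have "(r - e) * (V + V / r * e) = r * V - V / r * e\<^sup>2"
    using assms by (simp add: field_simps power2_eq_square)
  then show ?thesis using assms by simp
qed

text \<open>Here \<open>d = \<epsilon> exp(- 2 l x)\<close> is the correction added to the tail \<open>e = \<epsilon> exp(- l x)\<close>.  As \<open>exp(- 2 l x)\<close>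
decays faster than the critical exponential, it yields the surplus \<open>(V - r b) d\<close>, which pays for
the quadratic errors because \<open>e\<^sup>2 = \<epsilon> d\<close> carries an additional factor \<open>\<epsilon>\<close>.\<close>

lemma supersolution_flux:
  fixes V r K b e d \<epsilon> :: real
  assumes "0 < V" "0 < r" "0 \<le> K" "0 \<le> b" "0 \<le> d" "d \<le> e" "e\<^sup>2 = \<epsilon> * d"
    and small: "\<epsilon> * (r * K + V / r) \<le> V - r * b"
  shows "r * V \<le> (r - (e - d)) * (V + V / r * e - b * d - K * e\<^sup>2)"
proof -
  have "0 \<le> b * d" "0 \<le> K * e\<^sup>2" using assms(3-5) by auto
  then have "(e - d) * (V / r * e - b * d - K * e\<^sup>2) \<le> (e - d) * (V / r * e)"
    using assms(6) by (intro mult_left_mono) auto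
  also have "\<dots> \<le> e * (V / r * e)"
    using assms by (intro mult_right_mono) auto
  also have "\<dots> = V / r * (\<epsilon> * d)"
    using assms by (simp add: power2_eq_square)
  finally have *: "(e - d) * (V / r * e - b * d - K * e\<^sup>2) \<le> V / r * (\<epsilon> * d)" .
  have "d * (\<epsilon> * (r * K + V / r)) \<le> d * (V - r * b)"
    using assms by (intro mult_left_mono)
  then have **: "0 \<le> (V - r * b) * d - r * K * (\<epsilon> * d) - V / r * (\<epsilon> * d)"
    by (simp add: algebra_simps)
  have "(r - (e - d)) * (V + V / r * e - b * d - K * e\<^sup>2) =
      r * V + (V - r * b) * d - r * K * e\<^sup>2 - (e - d) * (V / r * e - b * d - K * e\<^sup>2)"
    using assms by (simp add: field_simps)
  with * ** assms(7) show ?thesis by simp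
qed

section \<open>The nonlocal speed reverses the order of profiles\<close>

text \<open>The look-ahead weight appears as the probability distribution \<open>\<mu>\<close> of the look-ahead distance, so
that averages of exponentials become Laplace transforms.  The velocity is a bounded monotone
function on the whole line, so that the averages make sense for every measurable \<open>P\<close>.\<close>

locale discontinuous_road =
  fixes \<mu> :: "real measure" and h \<kappa>m \<kappa>p :: real and v :: "real \<Rightarrow> real"
  assumes sets_\<mu>: "sets \<mu> = sets borel"
    and mass: "emeasure \<mu> UNIV = 1"
    and ahead: "AE s in \<mu>. 0 < s \<and> s < h"
    and drop: "0 < \<kappa>p" "\<kappa>p < \<kappa>m"
    and v_antimono: "antimono v"
    and v_cont: "continuous_on UNIV v"
    and v_range: "0 \<le> v \<rho>" "v \<rho> \<le> 1"
begin

definition road :: "real \<Rightarrow> real" where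
  "road y = (if y < 0 then \<kappa>m else \<kappa>p)"

definition avg :: "(real \<Rightarrow> real) \<Rightarrow> real \<Rightarrow> real" where
  "avg P x = (\<integral>s. road (x + s) * v (P (x + s)) \<partial>\<mu>)"

lemma space_\<mu> [simp]: "space \<mu> = UNIV"
  using sets_eq_imp_space_eq[OF sets_\<mu>] by simp

lemma finite_measure_\<mu>: "finite_measure \<mu>"
  by standard (simp add: mass)

lemma measurable_\<mu> [simp]: "borel_measurable \<mu> = borel_measurable borel"
  by (rule measurable_cong_sets[OF sets_\<mu> refl])

lemma measure_\<mu> [simp]: "measure \<mu> UNIV = 1"
  by (simp add: measure_def mass)

lemma integrable_of_bounded:
  fixes f :: "real \<Rightarrow> real"
  assumes "f \<in> borel_measurable borel" "AE s in \<mu>. \<bar>f s\<bar> \<le> B"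
  shows "integrable \<mu> f"
  using finite_measure.integrable_const_bound[OF finite_measure_\<mu>, of f B] assms
  by (simp only: measurable_\<mu> real_norm_def)

lemma v_measurable [measurable]: "v \<in> borel_measurable borel"
  using v_cont by (rule borel_measurable_continuous_onI)

lemma road_measurable [measurable]: "road \<in> borel_measurable borel"
  unfolding road_def[abs_def] by measurable

lemma road_bounds: "\<kappa>p \<le> road y" "road y \<le> \<kappa>m" "0 < road y" "0 \<le> road y"
  using drop by (auto simp: road_def)

lemma integrable_speed:
  assumes [measurable]: "P \<in> borel_measurable borel"
  shows "integrable \<mu> (\<lambda>s. road (x + s) * v (P (x + s)))"
proof (rule integrable_of_bounded)
  show "AE s in \<mu>. \<bar>road (x + s) * v (P (x + s))\<bar> \<le> \<kappa>m"
  proof (rule AE_I2)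
    fix s
    have "road (x + s) * v (P (x + s)) \<le> \<kappa>m * 1"
      using v_range road_bounds drop by (intro mult_mono) auto
    moreover have "0 \<le> road (x + s) * v (P (x + s))"
      using v_range road_bounds(4) by (intro mult_nonneg_nonneg) auto
    ultimately show "\<bar>road (x + s) * v (P (x + s))\<bar> \<le> \<kappa>m" by simp
  qed
qed measurable

lemma avg_ge:
  assumes "P \<in> borel_measurable borel" and "integrable \<mu> g"
    and "AE s in \<mu>. g s \<le> road (x + s) * v (P (x + s))"
  shows "(\<integral>s. g s \<partial>\<mu>) \<le> avg P x"
  unfolding avg_def using assms by (intro integral_mono_AE integrable_speed)

lemma avg_le:
  assumes "P \<in> borel_measurable borel" and "integrable \<mu> g"
    and "AE s in \<mu>. road (x + s) * v (P (x + s)) \<le> g s"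
  shows "avg P x \<le> (\<integral>s. g s \<partial>\<mu>)"
  unfolding avg_def using assms by (intro integral_mono_AE integrable_speed)

lemma avg_antimono:
  assumes "P \<in> borel_measurable borel" "Q \<in> borel_measurable borel" "\<And>y. P y \<le> Q y"
  shows "avg Q x \<le> avg P x"
  unfolding avg_def[of P]
  using assms road_bounds(4)
  by (intro avg_le integrable_speed AE_I2 mult_left_mono antimonoD[OF v_antimono])
    (auto simp: less_imp_le)

lemma mono_measurable: "mono P \<Longrightarrow> P \<in> borel_measurable borel" for P :: "real \<Rightarrow> real"
  by (rule borel_measurable_mono)

text \<open>Looking ahead from a point further right, the driver sees traffic at least
as dense and a road no better.\<close>

lemma avg_decreasing:
  assumes "mono P" "x \<le> y"
  shows "avg P y \<le> avg P x"
  unfolding avg_def[of P x]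
proof (intro avg_le integrable_speed AE_I2 mult_mono)
  fix s
  show "road (y + s) \<le> road (x + s)" using assms drop by (auto simp: road_def)
  show "v (P (y + s)) \<le> v (P (x + s))"
    using assms by (intro antimonoD[OF v_antimono] monoD[OF assms(1)]) auto
qed (use assms road_bounds(4) v_range in \<open>auto simp: mono_measurable less_imp_le\<close>)

lemma avg_lower_bound:
  assumes "P \<in> borel_measurable borel" "\<And>y. P y \<le> \<rho>"
  shows "\<kappa>p * v \<rho> \<le> avg P x"
proof -
  have "(\<integral>s. \<kappa>p * v \<rho> \<partial>\<mu>) \<le> avg P x"
    using assms road_bounds drop v_range
    by (intro avg_ge assms AE_I2 mult_mono antimonoD[OF v_antimono] integrable_of_bounded[of _ "\<bar>\<kappa>p * v \<rho>\<bar>"])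
      (auto simp: less_imp_le)
  then show ?thesis by simp
qed

lemma avg_upper_bound:
  assumes "P \<in> borel_measurable borel" "\<And>y. \<rho> \<le> P y"
  shows "avg P x \<le> \<kappa>m * v \<rho>"
proof -
  have "avg P x \<le> (\<integral>s. \<kappa>m * v \<rho> \<partial>\<mu>)"
    using assms road_bounds drop v_range
    by (intro avg_le assms AE_I2 mult_mono antimonoD[OF v_antimono] integrable_of_bounded[of _ "\<bar>\<kappa>m * v \<rho>\<bar>"])
      (auto simp: less_imp_le)
  then show ?thesis by simp
qed

text \<open>The fixed point is the pointwise supremum \<open>F\<close> of the set \<open>S\<close> of nondecreasing subsolutions below
\<open>U\<close>.  Enlarging \<open>P\<close> lowers \<open>avg P\<close>, so \<open>T = fbar / avg F\<close> dominates every member of \<open>S\<close> and hence \<open>F\<close>;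
for the same reason \<open>T\<close> is again a subsolution, and it stays below \<open>U\<close>.  Thus \<open>T\<close> belongs to \<open>S\<close> and
is dominated by \<open>F\<close>.  Taking a supremum of monotone functions keeps measurability for free.\<close>

lemma monotone_solution_between:
  assumes sub: "mono L" "\<And>x. L x \<le> U x" "\<And>x. L x * avg L x \<le> fbar" "\<And>x. \<rho>m \<le> L x"
    and super: "U \<in> borel_measurable borel" "\<And>x. fbar \<le> U x * avg U x" "\<And>x. U x \<le> \<rho>p"
    and pos: "0 < fbar" "0 < v \<rho>p" "0 < \<rho>m"
  obtains F where "mono F" "\<And>x. L x \<le> F x" "\<And>x. F x \<le> U x" "\<And>x. F x * avg F x = fbar"
proof -
  define S where "S = {P. mono P \<and> (\<forall>x. \<rho>m \<le> P x \<and> P x \<le> U x \<and> P x * avg P x \<le> fbar)}"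
  define F where "F x = (SUP P\<in>S. P x)" for x
  define T where "T x = fbar / avg F x" for x
  have L: "L \<in> S" using sub by (simp add: S_def)
  have bdd: "bdd_above ((\<lambda>P. P x) ` S)" for x
    by (rule bdd_aboveI[of _ "U x"]) (auto simp: S_def)
  have upper: "P x \<le> F x" if "P \<in> S" for P x
    unfolding F_def using that bdd by (rule cSUP_upper)
  have least: "F x \<le> c" if "\<And>P. P \<in> S \<Longrightarrow> P x \<le> c" for x c
    unfolding F_def using L that by (intro cSUP_least) auto
  have F_U: "F x \<le> U x" for x
    by (rule least) (simp add: S_def)
  have F_m: "\<rho>m \<le> F x" for x
    using upper[OF L, of x] sub(4)[of x] by simp
  have F_mono: "mono F"
  proof (rule monoI, rule least)
    fix x y :: real and P assume "x \<le> y" "P \<in> S"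
    then have "P x \<le> P y" by (auto simp: S_def mono_def)
    also have "\<dots> \<le> F y" by (rule upper) fact
    finally show "P x \<le> F y" .
  qed
  have avg_pos: "0 < avg P x" if "P \<in> borel_measurable borel" "\<And>y. P y \<le> U y" for P x
  proof -
    have "0 < \<kappa>p * v \<rho>p" using pos drop by simp
    also have "\<dots> \<le> avg P x"
      using that(2) super(3) by (intro avg_lower_bound that(1)) (meson order_trans)
    finally show ?thesis .
  qed
  have F_pos: "0 < avg F x" for x
    by (rule avg_pos[OF mono_measurable[OF F_mono] F_U])
  have F_T: "F x \<le> T x" for x
  proof (rule least)
    fix P assume P: "P \<in> S"
    then have "avg F x \<le> avg P x"
      using upper[OF P] F_mono by (intro avg_antimono mono_measurable) (auto simp: S_def)
    then have "P x * avg F x \<le> P x * avg P x"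
      using P pos(3) by (intro mult_left_mono) (auto simp: S_def intro: order_trans less_imp_le)
    also have "\<dots> \<le> fbar" using P by (simp add: S_def)
    finally show "P x \<le> T x" using F_pos by (simp add: T_def pos_le_divide_eq)
  qed
  have T_mono: "mono T"
    unfolding T_def using pos F_pos
    by (intro monoI divide_left_mono avg_decreasing[OF F_mono]) auto
  have "T \<in> S"
    unfolding S_def
  proof (intro CollectI conjI allI T_mono)
    fix x
    show "\<rho>m \<le> T x" using F_m F_T order_trans by blast
    have "avg U x \<le> avg F x"
      by (rule avg_antimono) (use F_U super F_mono mono_measurable in auto)
    then have "T x \<le> fbar / avg U x"
      unfolding T_def using pos F_pos avg_pos[of U x] super(1) by (intro divide_left_mono) auto
    also have "\<dots> \<le> U x"
      using super(2)[of x] avg_pos[of U x] super(1) by (simp add: divide_le_eq)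
    finally show "T x \<le> U x" .
    have "avg T x \<le> avg F x"
      by (rule avg_antimono) (use F_T F_mono T_mono mono_measurable in auto)
    then have "T x * avg T x \<le> T x * avg F x"
      using pos F_pos[of x] by (intro mult_left_mono) (auto simp: T_def)
    then show "T x * avg T x \<le> fbar" using F_pos[of x] by (simp add: T_def)
  qed
  then have "F x = T x" for x
    using F_T upper by (intro antisym) auto
  then have "F x * avg F x = fbar" for x
    using F_pos[of x] by (simp add: T_def)
  then show thesis using that F_mono F_U upper[OF L] by blast
qed

section \<open>Profiles with a prescribed tail\<close>

lemma exp_integrable: "0 \<le> l \<Longrightarrow> integrable \<mu> (\<lambda>s. exp (- l * s))"
  using ahead by (intro integrable_of_bounded[of _ 1]) (auto elim!: eventually_mono)

lemma integral_combination:
  fixes f g :: "real \<Rightarrow> real"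
  assumes "integrable \<mu> f" "integrable \<mu> g"
  shows "integrable \<mu> (\<lambda>s. k * (A + B * f s - C * g s))"
    and "(\<integral>s. k * (A + B * f s - C * g s) \<partial>\<mu>) = k * (A + B * (\<integral>s. f s \<partial>\<mu>) - C * (\<integral>s. g s \<partial>\<mu>))"
proof -
  note const = finite_measure.integrable_const[OF finite_measure_\<mu>, of A]
  note Bf = integrable_mult_right[OF assms(1), of B] and Cg = integrable_mult_right[OF assms(2), of C]
  note sum = Bochner_Integration.integrable_add[OF const Bf]
  note comb = Bochner_Integration.integrable_diff[OF sum Cg]
  show "integrable \<mu> (\<lambda>s. k * (A + B * f s - C * g s))"
    by (rule integrable_mult_right[OF comb])
  show "(\<integral>s. k * (A + B * f s - C * g s) \<partial>\<mu>) = k * (A + B * (\<integral>s. f s \<partial>\<mu>) - C * (\<integral>s. g s \<partial>\<mu>))"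
    by (simp only: integral_mult_right_zero Bochner_Integration.integral_diff[OF sum Cg]
        Bochner_Integration.integral_add[OF const Bf]) simp
qed

text \<open>The Laplace transform of \<open>\<mu>\<close> is continuous on \<open>[0, \<infinity>)\<close>, equals \<open>1\<close> at \<open>0\<close> and tends to \<open>0\<close>, since \<open>\<mu>\<close>
has no atom at \<open>0\<close>; so it attains \<open>1 / a\<close>.  It is strictly smaller at \<open>2 l\<close> because
\<open>exp(- 2 l s) < exp(- l s)\<close> for \<open>s > 0\<close>.\<close>

lemma decay_rate:
  assumes "1 < a"
  obtains l where "0 < l" "a * (\<integral>s. exp (- l * s) \<partial>\<mu>) = 1" "a * (\<integral>s. exp (- (2 * l) * s) \<partial>\<mu>) < 1"
proof -
  define q where "q l = (\<integral>s. exp (- l * s) \<partial>\<mu>)" for l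
  have cont: "continuous_on {0..} q"
  proof (rule continuous_on_sequentiallyI)
    fix u :: "nat \<Rightarrow> real" and l
    assume u: "\<forall>n. u n \<in> {0..}" "u \<longlonglongrightarrow> l"
    show "(\<lambda>n. q (u n)) \<longlonglongrightarrow> q l"
      unfolding q_def
    proof (rule integral_dominated_convergence[where w = "\<lambda>_. 1"])
      show "AE s in \<mu>. (\<lambda>n. exp (- u n * s)) \<longlonglongrightarrow> exp (- l * s)"
        by (intro AE_I2 tendsto_intros u)
      show "AE s in \<mu>. norm (exp (- u n * s)) \<le> 1" for n
        using ahead u by (auto elim!: eventually_mono)
    qed (auto intro!: integrable_of_bounded[of _ 1])
  qed
  have "(\<lambda>n. \<integral>s. exp (- real n * s) \<partial>\<mu>) \<longlonglongrightarrow> (\<integral>s. 0 \<partial>\<mu>)"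
  proof (rule integral_dominated_convergence[where w = "\<lambda>_. 1"])
    show "AE s in \<mu>. (\<lambda>n. exp (- real n * s)) \<longlonglongrightarrow> 0"
      using ahead
    proof eventually_elim
      case (elim s)
      then have "(\<lambda>n. exp (- s) ^ n) \<longlonglongrightarrow> 0" by (intro LIMSEQ_power_zero) simp
      then show ?case by (simp add: exp_of_nat_mult[symmetric])
    qed
    show "AE s in \<mu>. norm (exp (- real n * s)) \<le> 1" for n
      using ahead by (auto elim!: eventually_mono)
  qed (auto intro!: integrable_of_bounded[of _ 1])
  then have "(\<lambda>n. q (real n)) \<longlonglongrightarrow> 0" by (simp add: q_def)
  then have "eventually (\<lambda>n. q (real n) < 1 / a) sequentially"
    using assms by (intro order_tendstoD) auto
  then obtain n where n: "q (real n) < 1 / a" by (auto simp: eventually_sequentially)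
  have q0: "q 0 = 1" by (simp add: q_def)
  have "\<exists>l. 0 \<le> l \<and> l \<le> real n \<and> q l = 1 / a"
    using n assms q0 by (intro IVT2' continuous_on_subset[OF cont]) auto
  then obtain l where l: "0 \<le> l" "q l = 1 / a" by blast
  with q0 assms have "0 < l" by (cases "l = 0") auto
  have int: "integrable \<mu> (\<lambda>s. exp (- l * s) - exp (- (2 * l) * s))"
    using \<open>0 < l\<close> by (intro Bochner_Integration.integrable_diff exp_integrable) auto
  have nonneg: "AE s in \<mu>. 0 \<le> exp (- l * s) - exp (- (2 * l) * s)"
    using ahead \<open>0 < l\<close> by (auto elim!: eventually_mono)
  have diff: "(\<integral>s. exp (- l * s) - exp (- (2 * l) * s) \<partial>\<mu>) = q l - q (2 * l)"
    using exp_integrable[of l] exp_integrable[of "2*l"] \<open>0 < l\<close> by (simp add: q_def)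
  have "q l \<noteq> q (2 * l)"
  proof
    assume "q l = q (2 * l)"
    then have "AE s in \<mu>. exp (- l * s) - exp (- (2 * l) * s) = 0"
      using integral_nonneg_eq_0_iff_AE[OF int nonneg] diff by simp
    with ahead have "AE s in \<mu>. False"
      by eventually_elim (use \<open>0 < l\<close> in auto)
    then have "emeasure \<mu> UNIV = 0" by (simp add: AE_iff_null null_sets_def sets_\<mu>)
    with mass show False by simp
  qed
  moreover have "0 \<le> q l - q (2 * l)"
    unfolding diff[symmetric] by (rule integral_nonneg_AE[OF nonneg])
  ultimately have "q (2 * l) < 1 / a" using l by simp
  then show thesis
    using that[of l] \<open>0 < l\<close> l assms by (simp add: q_def field_simps)
qed


text \<open>The number \<open>c\<close> plays the role of \<open>- v'(\<rho>p)\<close>, and \<open>K\<close> bounds the second-order error of the tangent at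
\<open>\<rho>p\<close>.  The last smallness condition compares the quadratic errors, of size \<open>\<epsilon>\<close> relative to the
correction term, with the surplus of that correction at the rate \<open>2 l\<close>.\<close>

lemma connecting_profile_with_tail:
  assumes ends: "0 < \<rho>m" "\<rho>m < \<rho>p"
    and flux: "\<kappa>m * \<rho>m * v \<rho>m = fbar" "\<kappa>p * \<rho>p * v \<rho>p = fbar" "0 < fbar"
    and above: "\<And>\<rho>. \<rho>m < \<rho> \<Longrightarrow> \<rho> \<le> \<rho>p \<Longrightarrow> fbar < \<kappa>m * \<rho> * v \<rho>"
    and tangent: "\<And>\<eta>. 0 \<le> \<eta> \<Longrightarrow> \<eta> \<le> \<rho>p - \<rho>m \<Longrightarrow> v (\<rho>p - \<eta>) \<le> v \<rho>p + c * \<eta>"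
    and parabola: "\<And>\<eta>. 0 \<le> \<eta> \<Longrightarrow> \<eta> \<le> \<rho>p - \<rho>m \<Longrightarrow> v \<rho>p + c * \<eta> - K * \<eta>\<^sup>2 \<le> v (\<rho>p - \<eta>)"
    and coeffs: "0 \<le> c" "0 \<le> K"
    and rate: "0 < l" "\<rho>p * c * (\<integral>s. exp (- l * s) \<partial>\<mu>) = v \<rho>p"
    and small: "0 < \<epsilon>" "\<epsilon> \<le> \<rho>p - \<rho>m"
      "\<epsilon> * (\<rho>p * K + v \<rho>p / \<rho>p) \<le> v \<rho>p - \<rho>p * (c * (\<integral>s. exp (- (2 * l) * s) \<partial>\<mu>))"
  obtains F where "mono F" "\<And>x. \<rho>m \<le> F x" "\<And>x. F x \<le> \<rho>p" "\<And>x. F x * avg F x = fbar"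
    "(F \<longlongrightarrow> \<rho>m) at_bot"
    "\<And>x. 0 \<le> x \<Longrightarrow> \<rho>p - \<epsilon> * exp (- l * x) \<le> F x"
    "\<And>x. 0 \<le> x \<Longrightarrow> F x \<le> \<rho>p - (\<epsilon> * exp (- l * x) - \<epsilon> * exp (- (2 * l) * x))"
proof -
  define Q1 where "Q1 = (\<integral>s. exp (- l * s) \<partial>\<mu>)"
  define Q2 where "Q2 = (\<integral>s. exp (- (2 * l) * s) \<partial>\<mu>)"
  \<comment> \<open>Subsolution: the tail is cut off at the origin, to whose left only the constant \<open>\<rho>m\<close> is safe.\<close>
  define L where "L x = (if x < 0 then \<rho>m else \<rho>p - \<epsilon> * exp (- l * x))" for x
  \<comment> \<open>Supersolution: for \<open>x < 0\<close> the maximum vanishes and \<open>U\<close> is the constant \<open>\<rho>p\<close>.  It is not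
      monotone, since the difference of the exponentials first rises and then decays.\<close>
  define U where "U x = \<rho>p - \<epsilon> * max 0 (exp (- l * x) - exp (- (2 * l) * x))" for x
  have r: "0 < \<rho>p" using ends by simp
  have "v \<rho>p \<noteq> 0" using flux(2,3) by auto
  then have V: "0 < v \<rho>p" using v_range(1)[of \<rho>p] by simp
  have cQ1: "c * Q1 = v \<rho>p / \<rho>p" using rate(2) r by (simp add: Q1_def field_simps)
  have Q2: "0 \<le> Q2" unfolding Q2_def by (rule integral_nonneg_AE) auto
  have int1: "integrable \<mu> (\<lambda>s. exp (- l * s))" and int2: "integrable \<mu> (\<lambda>s. exp (- (2 * l) * s))"
    using rate(1) by (intro exp_integrable; simp)+
  note combination = integral_combination[OF int1 int2, folded Q1_def Q2_def]
  have small_exp: "\<epsilon> * exp (- l * x) \<le> \<rho>p - \<rho>m" if "0 \<le> x" for x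
  proof -
    have "\<epsilon> * exp (- l * x) \<le> \<epsilon>" using that small(1) rate(1) by simp
    with small(2) show ?thesis by simp
  qed
  have exp_le: "exp (- (2 * l) * x) \<le> exp (- l * x)" if "0 \<le> x" for x
    using that rate(1) by simp
  have U_neg: "U x = \<rho>p" if "x < 0" for x
    using that rate(1) by (simp add: U_def max_def)
  have U_pos: "U x = \<rho>p - (\<epsilon> * exp (- l * x) - \<epsilon> * exp (- (2 * l) * x))" if "0 \<le> x" for x
    using exp_le[OF that] by (simp add: U_def max_def algebra_simps)
  have mono_L: "mono L"
  proof (rule monoI)
    fix x y :: real assume "x \<le> y"
    then show "L x \<le> L y"
      using small small_exp[of y] rate(1) by (auto simp: L_def)
  qed
  have L_ge: "\<rho>m \<le> L x" for x
    using small small_exp[of x] by (auto simp: L_def)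
  have U_le: "U x \<le> \<rho>p" for x
    using small(1) by (auto simp: U_def)
  have L_U: "L x \<le> U x" for x
    using small(1) ends by (cases "x < 0") (auto simp: L_def U_neg U_pos)
  have U_meas: "U \<in> borel_measurable borel"
    unfolding U_def[abs_def] by measurable
  have sub: "L x * avg L x \<le> fbar" for x
  proof (cases "x < 0")
    case True
    have "avg L x \<le> \<kappa>m * v \<rho>m"
      by (rule avg_upper_bound[OF mono_measurable[OF mono_L] L_ge])
    then have "L x * avg L x \<le> \<rho>m * (\<kappa>m * v \<rho>m)"
      using True ends by (simp add: L_def)
    then show ?thesis using flux by (simp add: mult_ac)
  next
    case False
    define e where "e = \<epsilon> * exp (- l * x)"
    have e: "0 \<le> e" "e \<le> \<rho>p - \<rho>m" using small small_exp[of x] False by (auto simp: e_def)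
    define g where "g s = \<kappa>p * (v \<rho>p + c * e * exp (- l * s) - 0 * exp (- (2 * l) * s))" for s
    have "avg L x \<le> (\<integral>s. g s \<partial>\<mu>)"
    proof (rule avg_le[OF mono_measurable[OF mono_L]])
      show "integrable \<mu> g" unfolding g_def by (rule combination(1))
      show "AE s in \<mu>. road (x + s) * v (L (x + s)) \<le> g s"
        using ahead
      proof eventually_elim
        case (elim s)
        then have xs: "0 \<le> x + s" using False by simp
        have "L (x + s) = \<rho>p - e * exp (- l * s)"
          using xs by (simp add: L_def e_def exp_add[symmetric] algebra_simps)
        moreover have "e * exp (- l * s) \<le> \<rho>p - \<rho>m"
          using L_ge[of "x + s"] calculation by simp
        ultimately have "v (L (x + s)) \<le> v \<rho>p + c * (e * exp (- l * s))"
          using tangent[of "e * exp (- l * s)"] e by simp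
        then show ?case using xs drop by (simp add: road_def g_def mult_ac)
      qed
    qed
    also have "\<dots> = \<kappa>p * (v \<rho>p + c * Q1 * e)"
      unfolding g_def combination(2) by simp
    finally have "L x * avg L x \<le> L x * (\<kappa>p * (v \<rho>p + v \<rho>p / \<rho>p * e))"
      using L_ge[of x] ends unfolding cQ1 by (intro mult_left_mono) auto
    also have "\<dots> = \<kappa>p * ((\<rho>p - e) * (v \<rho>p + v \<rho>p / \<rho>p * e))"
      using False by (simp add: L_def e_def)
    also have "\<dots> \<le> \<kappa>p * (\<rho>p * v \<rho>p)"
      using subsolution_flux[OF V r] drop by (intro mult_left_mono) auto
    finally show ?thesis using flux by (simp add: mult_ac)
  qed
  have super: "fbar \<le> U x * avg U x" for x
  proof (cases "x < 0")
    case True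
    have "fbar = \<rho>p * (\<kappa>p * v \<rho>p)" using flux by (simp add: mult_ac)
    also have "\<dots> \<le> \<rho>p * avg U x"
      using avg_lower_bound[OF U_meas U_le, of x] r by (intro mult_left_mono) auto
    finally show ?thesis using U_neg[OF True] by simp
  next
    case False
    define e where "e = \<epsilon> * exp (- l * x)"
    define d where "d = \<epsilon> * exp (- (2 * l) * x)"
    have ed: "0 \<le> d" "d \<le> e" "e \<le> \<rho>p - \<rho>m"
      using small small_exp[of x] exp_le[of x] False by (auto simp: e_def d_def)
    have e2: "e\<^sup>2 = \<epsilon> * d"
      by (simp add: e_def d_def power_mult_distrib power2_eq_square exp_add[symmetric])
    define g where "g s = \<kappa>p * ((v \<rho>p - K * e\<^sup>2) + c * e * exp (- l * s) - c * d * exp (- (2 * l) * s))" for s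
    have "(\<integral>s. g s \<partial>\<mu>) \<le> avg U x"
    proof (rule avg_ge[OF U_meas])
      show "integrable \<mu> g" unfolding g_def by (rule combination(1))
      show "AE s in \<mu>. g s \<le> road (x + s) * v (U (x + s))"
        using ahead
      proof eventually_elim
        case (elim s)
        then have xs: "0 \<le> x + s" and s: "0 \<le> s" using False by auto
        define \<eta> where "\<eta> = e * exp (- l * s) - d * exp (- (2 * l) * s)"
        have U: "U (x + s) = \<rho>p - \<eta>"
          using U_pos[OF xs] by (simp add: \<eta>_def e_def d_def exp_add[symmetric] algebra_simps)
        have "d * exp (- (2 * l) * s) \<le> e * exp (- l * s)"
          using ed exp_le[OF s] by (intro mult_mono) auto
        moreover have "e * exp (- l * s) \<le> e"
          using ed s rate(1) by (simp add: mult_left_le)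
        moreover have "0 \<le> d * exp (- (2 * l) * s)"
          using ed by simp
        ultimately have \<eta>: "0 \<le> \<eta>" "\<eta> \<le> e" by (auto simp: \<eta>_def)
        then have "K * \<eta>\<^sup>2 \<le> K * e\<^sup>2"
          using coeffs by (intro mult_left_mono power_mono) auto
        then have "v \<rho>p + c * \<eta> - K * e\<^sup>2 \<le> v (U (x + s))"
          using parabola[of \<eta>] \<eta> ed U by simp
        then have "\<kappa>p * (v \<rho>p + c * \<eta> - K * e\<^sup>2) \<le> \<kappa>p * v (U (x + s))"
          using drop by (intro mult_left_mono) auto
        moreover have "g s = \<kappa>p * (v \<rho>p + c * \<eta> - K * e\<^sup>2)"
          by (simp add: g_def \<eta>_def algebra_simps)
        ultimately show ?case using xs by (simp add: road_def)
      qed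
    qed
    moreover have "(\<integral>s. g s \<partial>\<mu>) = \<kappa>p * (v \<rho>p + c * Q1 * e - c * Q2 * d - K * e\<^sup>2)"
      unfolding g_def combination(2) by (simp add: algebra_simps)
    ultimately have le: "\<kappa>p * (v \<rho>p + v \<rho>p / \<rho>p * e - c * Q2 * d - K * e\<^sup>2) \<le> avg U x"
      unfolding cQ1 by simp
    have "fbar = \<kappa>p * (\<rho>p * v \<rho>p)" using flux by (simp add: mult_ac)
    also have "\<dots> \<le> \<kappa>p * ((\<rho>p - (e - d)) * (v \<rho>p + v \<rho>p / \<rho>p * e - c * Q2 * d - K * e\<^sup>2))"
      using V r coeffs Q2 ed e2 small(3) drop unfolding Q2_def[symmetric]
      by (intro mult_left_mono supersolution_flux) auto
    also have "\<dots> = U x * (\<kappa>p * (v \<rho>p + v \<rho>p / \<rho>p * e - c * Q2 * d - K * e\<^sup>2))"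
      using U_pos[of x] False by (simp add: e_def d_def)
    also have "\<dots> \<le> U x * avg U x"
      using le L_ge[of x] L_U[of x] ends by (intro mult_left_mono) auto
    finally show ?thesis .
  qed
  obtain F where F: "mono F" "\<And>x. L x \<le> F x" "\<And>x. F x \<le> U x" "\<And>x. F x * avg F x = fbar"
    using monotone_solution_between[OF mono_L L_U sub L_ge U_meas super U_le flux(3) V ends(1)] by blast
  have F_range: "\<rho>m \<le> F x" "F x \<le> \<rho>p" for x
    using F(2)[of x] L_ge[of x] F(3)[of x] U_le[of x] by auto
  \<comment> \<open>Behaviour at \<open>-\<infinity>\<close>: for \<open>x \<le> - h\<close> the driver sees only the left road and no density above
      \<open>F (x + h)\<close>, which gives an inequality for the limit \<open>I\<close> in the local flux.\<close>
  define I where "I = (INF x. F x)"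
  have bdd: "bdd_below (range F)" by (rule bdd_belowI2[OF F_range(1)])
  have lim: "(F \<longlongrightarrow> I) at_bot"
  proof (rule decreasing_tendsto)
    show "\<forall>\<^sub>F x in at_bot. I \<le> F x"
      unfolding I_def by (intro always_eventually allI cINF_lower bdd) auto
    fix y assume "I < y"
    then obtain x0 where "F x0 < y" unfolding I_def by (auto simp: cINF_less_iff[OF _ bdd])
    then have "F x < y" if "x \<le> x0" for x
      using monoD[OF F(1) that] by simp
    then show "\<forall>\<^sub>F x in at_bot. F x < y"
      unfolding eventually_at_bot_linorder by blast
  qed
  have "filterlim (\<lambda>x. x + h) at_bot at_bot"
    unfolding filterlim_at_bot eventually_at_bot_linorder by (metis le_diff_eq)
  then have lim_h: "((\<lambda>x. F (x + h)) \<longlongrightarrow> I) at_bot"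
    by (rule filterlim_compose[OF lim])
  have "\<forall>\<^sub>F x in at_bot. \<kappa>m * F x * v (F (x + h)) \<le> fbar"
    unfolding eventually_at_bot_linorder
  proof (intro exI[of _ "- h"] allI impI)
    fix x assume x: "x \<le> - h"
    have "(\<integral>s. \<kappa>m * v (F (x + h)) \<partial>\<mu>) \<le> avg F x"
    proof (rule avg_ge[OF mono_measurable[OF F(1)]])
      show "integrable \<mu> (\<lambda>s. \<kappa>m * v (F (x + h)))"
        by (rule finite_measure.integrable_const[OF finite_measure_\<mu>])
      show "AE s in \<mu>. \<kappa>m * v (F (x + h)) \<le> road (x + s) * v (F (x + s))"
        using ahead
      proof eventually_elim
        case (elim s)
        then have "F (x + s) \<le> F (x + h)" by (intro monoD[OF F(1)]) simp
        then show ?case using elim x drop antimonoD[OF v_antimono] by (simp add: road_def)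
      qed
    qed
    then have "F x * (\<kappa>m * v (F (x + h))) \<le> F x * avg F x"
      using F_range[of x] ends by (intro mult_left_mono) auto
    then show "\<kappa>m * F x * v (F (x + h)) \<le> fbar" using F(4) by (simp add: mult_ac)
  qed
  moreover have "((\<lambda>x. \<kappa>m * F x * v (F (x + h))) \<longlongrightarrow> \<kappa>m * I * v I) at_bot"
    using v_cont by (intro tendsto_intros lim isCont_tendsto_compose[OF _ lim_h])
      (simp add: continuous_on_eq_continuous_at)
  ultimately have "\<kappa>m * I * v I \<le> fbar"
    by (intro tendsto_upperbound) (auto simp: trivial_limit_at_bot_linorder)
  moreover have "\<rho>m \<le> I" unfolding I_def by (rule cINF_greatest) (auto simp: F_range)
  moreover have "I \<le> \<rho>p" using cINF_lower[OF bdd, of 0] F_range(2)[of 0] by (simp add: I_def)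
  ultimately have "I = \<rho>m" using above[of I] by fastforce
  show thesis
  proof (rule that[OF F(1) F_range F(4)])
    show "(F \<longlongrightarrow> \<rho>m) at_bot" using lim \<open>I = \<rho>m\<close> by simp
    show "\<rho>p - \<epsilon> * exp (- l * x) \<le> F x" if "0 \<le> x" for x
      using F(2)[of x] that by (simp add: L_def)
    show "F x \<le> \<rho>p - (\<epsilon> * exp (- l * x) - \<epsilon> * exp (- (2 * l) * x))" if "0 \<le> x" for x
      using F(3)[of x] U_pos[OF that] by simp
  qed
qed

end

section \<open>The corner produced by a downward jump\<close>

lemma integrable_bounded_mult:
  fixes G f :: "real \<Rightarrow> real"
  assumes G: "G \<in> borel_measurable borel" "\<And>y. \<bar>G y\<bar> \<le> B" and f: "integrable lborel f"
  shows "integrable lborel (\<lambda>y. G y * f y)"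
proof (rule Bochner_Integration.integrable_bound)
  show "integrable lborel (\<lambda>y. B * f y)" using f by simp
  show "AE y in lborel. norm (G y * f y) \<le> norm (B * f y)"
    using G(2) by (intro AE_I2) (auto simp: abs_mult intro!: mult_right_mono intro: order_trans[OF _ abs_ge_self])
qed (use G(1) borel_measurable_integrable[OF f] in simp)

lemma integrable_shift:
  "integrable lborel f \<Longrightarrow> integrable lborel (\<lambda>s. f (s + t))" for f :: "real \<Rightarrow> real"
  using lborel_integrable_real_affine[of f 1 t] by (simp add: add.commute)

lemma integral_shift:
  "(\<integral>s. f (s + t) \<partial>lborel) = (\<integral>s. f s \<partial>lborel)" for f :: "real \<Rightarrow> real"
  using lborel_integral_real_affine[of 1 f t] by (simp add: add.commute)

lemma integrable_on_bounded:
  assumes "bounded S" "S \<in> sets borel"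
  shows "integrable lborel (\<lambda>s. c * indicator S s :: real)"
  using emeasure_bounded_finite[OF assms(1)] assms(2)
  by (intro integrable_mult_right integrable_real_indicator) auto

definition weight_measure :: "(real \<Rightarrow> real) \<Rightarrow> real measure" where
  "weight_measure W = density lborel W"

locale look_ahead_weight =
  fixes W :: "real \<Rightarrow> real" and h M :: real
  assumes W_support: "s \<le> 0 \<or> h \<le> s \<Longrightarrow> W s = 0"
    and W_nonneg: "0 \<le> W s"
    and W_bound: "W s \<le> M"
    and W_decreasing: "0 < s \<Longrightarrow> s \<le> t \<Longrightarrow> W t \<le> W s"
    and W_cont: "s \<noteq> 0 \<Longrightarrow> isCont W s"
    and W_measurable: "W \<in> borel_measurable borel"
    and h_pos: "0 < h"
begin

lemma W_integrable: "integrable lborel W"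
proof (rule Bochner_Integration.integrable_bound)
  show "integrable lborel (\<lambda>s. M * indicator {0..h} s :: real)"
    by (intro integrable_on_bounded) auto
  show "AE s in lborel. norm (W s) \<le> norm (M * indicator {0..h} s :: real)"
    using W_support W_nonneg W_bound by (intro AE_I2) (auto simp: indicator_def intro: order_trans[OF _ abs_ge_self])
qed (use W_measurable in simp)

definition conv :: "(real \<Rightarrow> real) \<Rightarrow> real \<Rightarrow> real" where
  "conv g x = (\<integral>s. g (x + s) * W s \<partial>lborel)"

lemma conv_integrable:
  assumes [measurable]: "g \<in> borel_measurable borel" and "\<And>y. \<bar>g y\<bar> \<le> B"
  shows "integrable lborel (\<lambda>s. g (x + s) * W s)"
  using assms(2) by (intro integrable_bounded_mult[of _ B] W_integrable) measurable

lemma conv_integrable':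
  assumes "g \<in> borel_measurable borel" and "\<And>y. \<bar>g y\<bar> \<le> B"
  shows "integrable lborel (\<lambda>y. g y * W (y - x))"
  using integrable_shift[OF W_integrable, of "- x"] assms by (intro integrable_bounded_mult[of _ B]) simp_all

lemma conv_eq: "conv g x = (\<integral>y. g y * W (y - x) \<partial>lborel)"
  using integral_shift[of "\<lambda>y. g y * W (y - x)" x] by (simp add: conv_def add.commute)

text \<open>As \<open>x\<close> moves, only the translate of the weight changes, and it converges at every point but one.\<close>

lemma isCont_conv:
  assumes [measurable]: "g \<in> borel_measurable borel" and g: "\<And>y. \<bar>g y\<bar> \<le> B"
  shows "isCont (conv g) x"
proof (subst continuous_at_sequentially, intro allI impI)
  fix u :: "nat \<Rightarrow> real" assume u: "u \<longlonglongrightarrow> x"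
  then have "Bseq u" by (intro convergent_imp_Bseq convergentI)
  then obtain C where C: "\<And>n. \<bar>u n\<bar> \<le> C" by (auto simp: Bseq_def)
  have B: "0 \<le> B" using g[of 0] by simp
  have M: "0 \<le> M" using W_nonneg[of 0] W_bound[of 0] by simp
  note [measurable] = W_measurable
  have "(\<lambda>n. \<integral>y. g y * W (y - u n) \<partial>lborel) \<longlonglongrightarrow> (\<integral>y. g y * W (y - x) \<partial>lborel)"
  proof (rule integral_dominated_convergence[where w = "\<lambda>y. B * M * indicator {- C..C + h} y"])
    show "AE y in lborel. (\<lambda>n. g y * W (y - u n)) \<longlonglongrightarrow> g y * W (y - x)"
      using AE_lborel_singleton[of x]
    proof eventually_elim
      case (elim y)
      then have "isCont W (y - x)" by (intro W_cont) simp
      then show ?case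
        by (intro tendsto_intros isCont_tendsto_compose[of _ W] u)
    qed
    show "AE y in lborel. norm (g y * W (y - u n)) \<le> B * M * indicator {- C..C + h} y" for n
    proof (rule AE_I2)
      fix y
      show "norm (g y * W (y - u n)) \<le> B * M * indicator {- C..C + h} y"
      proof (cases "y \<in> {- C..C + h}")
        case True
        then show ?thesis
          using g[of y] W_bound[of "y - u n"] W_nonneg[of "y - u n"] B M
          by (simp add: abs_mult mult_mono)
      next
        case False
        then have "W (y - u n) = 0"
          using C[of n] by (intro W_support) auto
        with False show ?thesis by simp
      qed
    qed
    show "integrable lborel (\<lambda>y. B * M * indicator {- C..C + h} y :: real)"
      by (intro integrable_on_bounded) auto
  qed measurable
  then show "(conv g \<circ> u) \<longlonglongrightarrow> conv g x" by (simp add: conv_eq comp_def)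
qed

text \<open>The second difference is the integral of
\<open>D s = (g (s + t) - g s) (W s - W (s + t))\<close>.  On \<open>- t < s < 0\<close> both factors have the sign that
produces the corner: \<open>g\<close> crosses its jump while \<open>W s\<close> still vanishes, so \<open>D s \<ge> 2 j W (s + t)\<close>.
For \<open>s > 0\<close> the monotonicity of \<open>W\<close> and the small oscillation of \<open>g\<close> give
\<open>D s \<ge> - j (W s - W (s + t))\<close>.  Adding \<open>j (W s - W (s + t))\<close>, whose integral over the line
is zero, leaves at least \<open>j W (s + t) \<ge> j W c\<close> on an interval of length \<open>t\<close>.\<close>

lemma second_difference_lower_bound:
  assumes g: "g \<in> borel_measurable borel" "\<And>y. \<bar>g y\<bar> \<le> B" "antimono g"
    and jump: "\<And>y z. y < 0 \<Longrightarrow> 0 < z \<Longrightarrow> 2 * j \<le> g y - g z"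
    and osc: "\<And>s. 0 < s \<Longrightarrow> s < h \<Longrightarrow> g s - g (s + t) \<le> j"
    and t: "0 < t" "t \<le> c" and j: "0 \<le> j"
  shows "j * W c * t \<le> conv g t - 2 * conv g 0 + conv g (- t)"
proof -
  note int = conv_integrable[OF g(1,2)]
  define D where "D s = (g (s + t) - g s) * (W s - W (s + t))" for s
  define E where "E s = g s * W s - g (s - t) * W s" for s
  have intE: "integrable lborel E"
    using Bochner_Integration.integrable_diff[OF int[of 0] int[of "-t"]] by (simp add: E_def[abs_def])
  have D_eq: "D = (\<lambda>s. (g (t + s) * W s - g (0 + s) * W s) - E (s + t))"
    by (auto simp: D_def E_def algebra_simps)
  have intD: "integrable lborel D"
    unfolding D_eq by (intro Bochner_Integration.integrable_diff int integrable_shift intE)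
  have "(\<integral>s. D s \<partial>lborel) = (conv g t - conv g 0) - (\<integral>s. E (s + t) \<partial>lborel)"
    unfolding D_eq conv_def
    by (simp only: Bochner_Integration.integral_diff Bochner_Integration.integrable_diff int integrable_shift intE)
  also have "(\<integral>s. E (s + t) \<partial>lborel) = conv g 0 - conv g (- t)"
    unfolding integral_shift using Bochner_Integration.integral_diff[OF int[of 0] int[of "-t"]]
    by (simp add: E_def[abs_def] conv_def)
  finally have intD_eq: "(\<integral>s. D s \<partial>lborel) = conv g t - 2 * conv g 0 + conv g (- t)" by simp
  define R where "R s = j * W c * indicator {- t<..<0} s - j * (W s - W (s + t))" for s
  have ind: "integrable lborel (\<lambda>s. j * W c * indicator {- t<..<0} s :: real)"
    by (intro integrable_on_bounded) auto
  have Wd: "integrable lborel (\<lambda>s. j * (W s - W (s + t)))"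
    by (intro integrable_mult_right Bochner_Integration.integrable_diff W_integrable integrable_shift)
  have "(\<integral>s. R s \<partial>lborel) = j * W c * t - j * ((\<integral>s. W s \<partial>lborel) - (\<integral>s. W (s + t) \<partial>lborel))"
    unfolding R_def using t
    by (simp add: Bochner_Integration.integral_diff[OF ind Wd] Bochner_Integration.integral_diff W_integrable integrable_shift)
  then have "(\<integral>s. R s \<partial>lborel) = j * W c * t" by (simp add: integral_shift)
  moreover have "(\<integral>s. R s \<partial>lborel) \<le> (\<integral>s. D s \<partial>lborel)"
  proof (rule integral_mono_AE)
    show "integrable lborel R"
      unfolding R_def by (rule Bochner_Integration.integrable_diff[OF ind Wd])
    show "AE s in lborel. R s \<le> D s"
      using AE_lborel_singleton[of 0]
    proof eventually_elim
      case (elim s)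
      consider "0 < s" "s < h" | "h \<le> s" | "- t < s" "s < 0" | "s \<le> - t" "s < 0"
        using elim by linarith
      then show ?case
      proof cases
        case 1
        then have "(g s - g (s + t)) * (W s - W (s + t)) \<le> j * (W s - W (s + t))"
          using osc[of s] W_decreasing[of s "s + t"] t by (intro mult_right_mono) auto
        with 1 show ?thesis by (simp add: R_def D_def algebra_simps)
      next
        case 2
        then show ?thesis using W_support t h_pos by (simp add: R_def D_def)
      next
        case 3
        have "j * W c \<le> j * W (s + t)"
          using 3 t j W_decreasing[of "s + t" c] by (intro mult_left_mono) auto
        moreover have "2 * j * W (s + t) \<le> (g s - g (s + t)) * W (s + t)"
          using 3 jump[of s "s + t"] W_nonneg by (intro mult_right_mono) auto
        moreover have "W s = 0" using 3 W_support by simp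
        ultimately show ?thesis using 3 by (simp add: R_def D_def algebra_simps)
      next
        case 4
        then show ?thesis using W_support by (simp add: R_def D_def)
      qed
    qed
  qed (rule intD)
  ultimately show ?thesis using intD_eq by simp
qed

lemma conv_not_differentiable:
  assumes g: "g \<in> borel_measurable borel" "\<And>y. \<bar>g y\<bar> \<le> B" "antimono g"
    and j: "0 < j" and jump: "\<And>y z. y < 0 \<Longrightarrow> 0 < z \<Longrightarrow> 2 * j \<le> g y - g z"
    and osc: "\<forall>\<^sub>F t in at_right 0. \<forall>s. 0 < s \<longrightarrow> s < h \<longrightarrow> g s - g (s + t) \<le> j"
    and c: "0 < c" "0 < W c"
  shows "\<not> conv g differentiable (at 0)"
proof
  assume "conv g differentiable (at 0)"
  then obtain d where d: "(conv g has_real_derivative d) (at 0)"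
    by (auto simp: real_differentiable_def)
  have quot: "((\<lambda>t. (conv g t - conv g 0) / t) \<longlongrightarrow> d) (at 0)"
    using d by (simp add: has_field_derivative_iff)
  have right: "((\<lambda>t. (conv g t - conv g 0) / t) \<longlongrightarrow> d) (at_right 0)"
    by (rule tendsto_mono[OF at_le quot]) simp
  have "((\<lambda>t. (conv g t - conv g 0) / t) \<longlongrightarrow> d) (at_left 0)"
    by (rule tendsto_mono[OF at_le quot]) simp
  then have left: "((\<lambda>t. (conv g (- t) - conv g 0) / (- t)) \<longlongrightarrow> d) (at_right 0)"
    by (simp add: filterlim_at_left_to_right)
  have "((\<lambda>t. (conv g t - conv g 0) / t - (conv g (- t) - conv g 0) / (- t)) \<longlongrightarrow> d - d) (at_right 0)"
    by (rule tendsto_diff[OF right left])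
  moreover have "\<forall>\<^sub>F t in at_right 0. j * W c \<le>
      (conv g t - conv g 0) / t - (conv g (- t) - conv g 0) / (- t)"
    using osc eventually_at_right_real[OF c(1)]
  proof eventually_elim
    case (elim t)
    then have "j * W c * t \<le> conv g t - 2 * conv g 0 + conv g (- t)"
      using j by (intro second_difference_lower_bound[OF g jump]) auto
    with elim have "j * W c \<le> (conv g t - 2 * conv g 0 + conv g (- t)) / t"
      by (simp add: pos_le_divide_eq)
    also have "\<dots> = (conv g t - conv g 0) / t - (conv g (- t) - conv g 0) / (- t)"
      by (simp add: add_divide_distrib diff_divide_distrib)
    finally show ?case .
  qed
  ultimately have "j * W c \<le> d - d"
    by (intro tendsto_lowerbound) auto
  with j c show False by (simp add: mult_le_0_iff)
qed

text \<open>Two points are exceptional: the origin, where the road parameter may take any value, and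
\<open>y = x\<close>, where \<open>w\<close> is evaluated at \<open>0\<close>.\<close>

lemma has_integral_conv:
  assumes g: "g \<in> borel_measurable borel" "\<And>y. \<bar>g y\<bar> \<le> B"
    and f: "\<And>y. y \<noteq> 0 \<Longrightarrow> f y = g y"
    and w: "\<And>s. 0 < s \<Longrightarrow> s \<le> h \<Longrightarrow> w s = W s"
  shows "((\<lambda>y. f y * w (y - x)) has_integral conv g x) {x..x + h}"
proof -
  have "((\<lambda>y. g y * W (y - x)) has_integral conv g x) UNIV"
    unfolding conv_eq by (rule has_integral_integral_lborel[OF conv_integrable'[OF g]])
  also have "(\<lambda>y. g y * W (y - x)) = (\<lambda>y. if y \<in> {x..x + h} then g y * W (y - x) else 0)"
    using W_support by (auto simp: fun_eq_iff)
  finally have "((\<lambda>y. g y * W (y - x)) has_integral conv g x) {x..x + h}"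
    unfolding has_integral_restrict_UNIV .
  then show ?thesis
    by (rule has_integral_spike_finite[of "{0, x}", rotated 2]) (use f w in auto)
qed

lemma AE_weight_measure: "AE s in weight_measure W. 0 < s \<and> s < h"
  unfolding weight_measure_def
proof (subst AE_density)
  show "AE s in lborel. 0 < ennreal (W s) \<longrightarrow> 0 < s \<and> s < h"
    using W_support by (intro AE_I2) (metis ennreal_0 less_irrefl not_le)
qed (use W_measurable in simp)

lemma emeasure_weight_measure: "emeasure (weight_measure W) UNIV = ennreal (\<integral>s. W s \<partial>lborel)"
  using W_measurable W_nonneg
  by (simp add: weight_measure_def emeasure_density nn_integral_eq_integral[OF W_integrable])

lemma integral_weight_measure:
  assumes [measurable]: "g \<in> borel_measurable borel"
  shows "(\<integral>s. g (x + s) \<partial>weight_measure W) = conv g x"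
  using W_measurable W_nonneg unfolding weight_measure_def conv_def
  by (subst integral_density) (auto simp: mult.commute)

end

section \<open>Profiles on the weighted road\<close>

locale weighted_road =
  look_ahead_weight W h M + discontinuous_road "weight_measure W" h \<kappa>m \<kappa>p v
  for W :: "real \<Rightarrow> real" and h M \<kappa>m \<kappa>p :: real and v :: "real \<Rightarrow> real"
begin

definition speed :: "(real \<Rightarrow> real) \<Rightarrow> real \<Rightarrow> real" where
  "speed P y = road y * v (P y)"

lemma speed_measurable: "P \<in> borel_measurable borel \<Longrightarrow> speed P \<in> borel_measurable borel"
  unfolding speed_def[abs_def] by measurable

lemma speed_bounded: "\<bar>speed P y\<bar> \<le> \<kappa>m"
proof -
  have "speed P y \<le> \<kappa>m * 1"
    using v_range road_bounds drop unfolding speed_def by (intro mult_mono) auto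
  moreover have "0 \<le> speed P y"
    using v_range road_bounds(4) unfolding speed_def by simp
  ultimately show ?thesis by simp
qed

lemma avg_eq_conv:
  assumes "P \<in> borel_measurable borel"
  shows "avg P = conv (speed P)"
  using integral_weight_measure[OF speed_measurable[OF assms]]
  by (auto simp: avg_def speed_def fun_eq_iff)

lemma isCont_profile:
  assumes "P \<in> borel_measurable borel" and P: "\<And>x. P x * avg P x = fbar" and "fbar \<noteq> 0"
  shows "isCont P x"
proof -
  have nz: "avg P x \<noteq> 0" for x using P[of x] assms(3) by auto
  then have "P = (\<lambda>x. fbar / avg P x)" using P by (auto simp: fun_eq_iff field_simps)
  moreover have "isCont (avg P) x"
    unfolding avg_eq_conv[OF assms(1)]
    by (rule isCont_conv[OF speed_measurable[OF assms(1)] speed_bounded])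
  then have "isCont (\<lambda>x. fbar / avg P x) x" using nz by (intro continuous_intros)
  ultimately show ?thesis by simp
qed

lemma antimono_speed:
  assumes "mono P"
  shows "antimono (speed P)"
proof (rule antimonoI)
  fix x y :: real assume "x \<le> y"
  then show "speed P y \<le> speed P x"
    unfolding speed_def using drop v_range road_bounds(4)
    by (intro mult_mono antimonoD[OF v_antimono] monoD[OF assms]) (auto simp: road_def)
qed

text \<open>A profile is the reciprocal of its averaged speed up to a factor, so it inherits the corner.  The
jump of the speed at the origin is at least \<open>(\<kappa>m - \<kappa>p) v(P(0))\<close>; half of it is kept as the
margin \<open>j\<close> against the oscillation of the speed on the right.\<close>

lemma profile_not_differentiable:
  assumes "mono P" and P: "\<And>x. P x * avg P x = fbar" and "fbar \<noteq> 0"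
    and v0: "0 < v (P 0)" and c: "0 < c" "0 < W c"
  shows "\<not> P differentiable (at 0)"
proof
  assume diff: "P differentiable (at 0)"
  have meas: "P \<in> borel_measurable borel" by (rule mono_measurable) fact
  have nz: "P x \<noteq> 0" for x using P[of x] \<open>fbar \<noteq> 0\<close> by auto
  define j where "j = (\<kappa>m - \<kappa>p) * v (P 0) / 2"
  have j: "0 < j" using drop v0 by (simp add: j_def)
  have corner: "\<not> conv (speed P) differentiable (at 0)"
  proof (rule conv_not_differentiable[OF speed_measurable[OF meas] speed_bounded antimono_speed[OF \<open>mono P\<close>] j _ _ c])
    fix y z :: real assume yz: "y < 0" "0 < z"
    have "\<kappa>m * v (P 0) \<le> speed P y"
      using yz drop by (auto simp: speed_def road_def intro!: antimonoD[OF v_antimono] monoD[OF \<open>mono P\<close>])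
    moreover have "speed P z \<le> \<kappa>p * v (P 0)"
      using yz drop by (auto simp: speed_def road_def intro!: antimonoD[OF v_antimono] monoD[OF \<open>mono P\<close>])
    ultimately show "2 * j \<le> speed P y - speed P z" by (simp add: j_def left_diff_distrib)
  next
    have "continuous_on UNIV P"
      using isCont_profile[OF meas P \<open>fbar \<noteq> 0\<close>] by (simp add: continuous_on_eq_continuous_at)
    then have "continuous_on UNIV (\<lambda>y. \<kappa>p * v (P y))"
      by (intro continuous_intros continuous_on_compose2[OF v_cont]) auto
    then have "uniformly_continuous_on {0..2 * h} (\<lambda>y. \<kappa>p * v (P y))"
      by (intro compact_uniformly_continuous) (auto intro: continuous_on_subset)
    then obtain d where d: "0 < d" "\<And>x y. x \<in> {0..2 * h} \<Longrightarrow> y \<in> {0..2 * h} \<Longrightarrow> dist y x < d \<Longrightarrow>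
        dist (\<kappa>p * v (P y)) (\<kappa>p * v (P x)) < j"
      unfolding uniformly_continuous_on_def using j by metis
    show "\<forall>\<^sub>F t in at_right 0. \<forall>s. 0 < s \<longrightarrow> s < h \<longrightarrow> speed P s - speed P (s + t) \<le> j"
      using eventually_at_right_real[OF d(1)] eventually_at_right_real[OF h_pos]
    proof eventually_elim
      case (elim t)
      show ?case
      proof (intro allI impI)
        fix s assume "0 < s" "s < h"
        then show "speed P s - speed P (s + t) \<le> j"
          using elim d(2)[of "s + t" s] by (auto simp: speed_def road_def dist_real_def)
      qed
    qed
  qed
  have "conv (speed P) = (\<lambda>x. fbar / P x)"
    using P nz by (auto simp: avg_eq_conv[OF meas] fun_eq_iff field_simps)
  then have "conv (speed P) differentiable (at 0)"
    using diff nz by (auto intro!: derivative_intros)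
  with corner show False by blast
qed

lemma flux_eq:
  assumes u: "u \<in> borel_measurable borel"
    and \<kappa>: "\<And>y. y < 0 \<Longrightarrow> \<kappa> y = \<kappa>m" "\<And>y. 0 < y \<Longrightarrow> \<kappa> y = \<kappa>p"
    and V: "\<And>y. V (u y) = v (u y)"
    and w: "\<And>s. 0 < s \<Longrightarrow> s \<le> h \<Longrightarrow> w s = W s"
  shows "nonlocal_flux \<kappa> V w h u x = u x * avg u x"
proof -
  have "((\<lambda>y. \<kappa> y * V (u y) * w (y - x)) has_integral conv (speed u) x) {x..x + h}"
  proof (rule has_integral_conv[OF speed_measurable[OF u] speed_bounded _ w])
    show "\<kappa> y * V (u y) = speed u y" if "y \<noteq> 0" for y
      using \<kappa> V that by (cases "y < 0") (auto simp: speed_def road_def)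
  qed
  then show ?thesis
    by (simp add: nonlocal_flux_def avg_eq_conv[OF u] integral_unique)
qed

end

section \<open>Concave velocities and the count of profiles\<close>

lemma mean_value_within:
  fixes f f' :: "real \<Rightarrow> real"
  assumes "\<And>x. x \<in> S \<Longrightarrow> (f has_real_derivative f' x) (at x within S)" "{a..b} \<subseteq> S" "a < b"
  obtains x where "a < x" "x < b" "f b - f a = f' x * (b - a)"
proof -
  have "\<exists>x\<in>{a<..<b}. f b - f a = (*) (f' x) (b - a)"
  proof (rule mvt_simple[OF \<open>a < b\<close>])
    fix x assume "a \<le> x" "x \<le> b"
    then have "(f has_real_derivative f' x) (at x within {a..b})"
      using assms by (intro DERIV_subset[OF assms(1)]) auto
    then show "(f has_derivative (*) (f' x)) (at x within {a..b})"
      by (simp add: has_field_derivative_def)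
  qed
  then show thesis using that by auto
qed

text \<open>The mean value theorem, applied to \<open>v\<close> and then to \<open>v'\<close>, compares the chord below \<open>r\<close> with the
tangent at \<open>r\<close>.  The upper bound is concavity; in the lower one \<open>K\<close> is a bound for \<open>\<bar>v''\<bar>\<close>.\<close>

lemma concave_tangent_parabola:
  fixes v v' v'' :: "real \<Rightarrow> real"
  assumes v: "\<And>r. r \<in> {0..1} \<Longrightarrow> (v has_real_derivative v' r) (at r within {0..1})"
    and v': "\<And>r. r \<in> {0..1} \<Longrightarrow> (v' has_real_derivative v'' r) (at r within {0..1})"
    and "continuous_on {0..1} v''" and concave: "\<And>r. r \<in> {0..1} \<Longrightarrow> v'' r \<le> 0"
  obtains K where "0 \<le> K"
    "\<And>r \<eta>. r \<le> 1 \<Longrightarrow> 0 \<le> \<eta> \<Longrightarrow> \<eta> \<le> r \<Longrightarrow> v (r - \<eta>) \<le> v r - v' r * \<eta>"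
    "\<And>r \<eta>. r \<le> 1 \<Longrightarrow> 0 \<le> \<eta> \<Longrightarrow> \<eta> \<le> r \<Longrightarrow> v r - v' r * \<eta> - K * \<eta>\<^sup>2 \<le> v (r - \<eta>)"
proof -
  have "bounded (v'' ` {0..1})"
    using assms(3) by (intro compact_imp_bounded compact_continuous_image) auto
  then obtain K where "\<forall>r\<in>{0..1}. \<bar>v'' r\<bar> \<le> K" by (auto simp: bounded_iff)
  then have K: "\<bar>v'' r\<bar> \<le> K" if "r \<in> {0..1}" for r using that by blast
  have "0 \<le> K" using K[of 0] by simp
  have both: "v (r - \<eta>) \<le> v r - v' r * \<eta> \<and> v r - v' r * \<eta> - K * \<eta>\<^sup>2 \<le> v (r - \<eta>)"
    if r: "r \<le> 1" "0 \<le> \<eta>" "\<eta> \<le> r" for r \<eta>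
  proof (cases "\<eta> = 0")
    case False
    obtain x where x: "r - \<eta> < x" "x < r" "v r - v (r - \<eta>) = v' x * (r - (r - \<eta>))"
      by (rule mean_value_within[of "{0..1}" v v' "r - \<eta>" r]) (use v r False in auto)
    obtain z where z: "x < z" "z < r" "v' r - v' x = v'' z * (r - x)"
      by (rule mean_value_within[of "{0..1}" v' v'' x r]) (use v' r x in auto)
    have "v'' z \<le> 0" "- K \<le> v'' z"
      using concave[of z] K[of z] r x z by auto
    then have "v'' z * (r - x) \<le> 0" "- K * (r - x) \<le> v'' z * (r - x)"
      using x by (intro mult_nonpos_nonneg mult_right_mono; simp)+
    moreover have "K * (r - x) \<le> K * \<eta>"
      using x \<open>0 \<le> K\<close> by (intro mult_left_mono) auto
    ultimately have "v' r \<le> v' x" "v' x \<le> v' r + K * \<eta>" using z by auto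
    then have "v' r * \<eta> \<le> v' x * \<eta>" "v' x * \<eta> \<le> (v' r + K * \<eta>) * \<eta>"
      using r by (auto intro!: mult_right_mono)
    then show ?thesis using x(3) by (simp add: algebra_simps power2_eq_square)
  qed simp
  show thesis using that[OF \<open>0 \<le> K\<close>] both by blast
qed

lemma tendsto_exp_decay: "0 < l \<Longrightarrow> ((\<lambda>x. exp (- l * x)) \<longlongrightarrow> 0) at_top" for l :: real
  by (rule filterlim_compose[OF exp_at_bot])
    (rule filterlim_tendsto_neg_mult_at_bot[OF tendsto_const _ filterlim_ident]; simp)

text \<open>Multiplying both bounds by \<open>exp(l x)\<close> and letting \<open>x\<close> tend to infinity recovers \<open>\<epsilon>\<close> from \<open>F \<epsilon>\<close>,
so \<open>F\<close> is injective on \<open>(0, \<epsilon>0]\<close>.\<close>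

lemma infinite_by_tail_coefficient:
  fixes F :: "real \<Rightarrow> real \<Rightarrow> real"
  assumes "0 < \<epsilon>0" "0 < l"
    and member: "\<And>\<epsilon>. 0 < \<epsilon> \<Longrightarrow> \<epsilon> \<le> \<epsilon>0 \<Longrightarrow> F \<epsilon> \<in> S"
    and lower: "\<And>\<epsilon> x. 0 < \<epsilon> \<Longrightarrow> \<epsilon> \<le> \<epsilon>0 \<Longrightarrow> 0 \<le> x \<Longrightarrow> r - \<epsilon> * exp (- l * x) \<le> F \<epsilon> x"
    and upper: "\<And>\<epsilon> x. 0 < \<epsilon> \<Longrightarrow> \<epsilon> \<le> \<epsilon>0 \<Longrightarrow> 0 \<le> x \<Longrightarrow>
      F \<epsilon> x \<le> r - (\<epsilon> * exp (- l * x) - \<epsilon> * exp (- (2 * l) * x))"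
  shows "infinite S"
proof -
  have le: "\<delta> \<le> \<epsilon>" if \<epsilon>: "0 < \<epsilon>" "\<epsilon> \<le> \<epsilon>0" and \<delta>: "0 < \<delta>" "\<delta> \<le> \<epsilon>0" and eq: "F \<epsilon> = F \<delta>" for \<epsilon> \<delta>
  proof -
    have "\<delta> * (1 - exp (- l * x)) \<le> \<epsilon>" if "0 \<le> x" for x
    proof -
      have "\<delta> * exp (- l * x) - \<delta> * exp (- (2 * l) * x) \<le> \<epsilon> * exp (- l * x)"
        using lower[OF \<epsilon> that] upper[OF \<delta> that] eq by simp
      then have "(\<delta> * (1 - exp (- l * x))) * exp (- l * x) \<le> \<epsilon> * exp (- l * x)"
        by (simp add: algebra_simps exp_add[symmetric])
      then show ?thesis by simp
    qed
    then have "\<forall>\<^sub>F x in at_top. \<delta> * (1 - exp (- l * x)) \<le> \<epsilon>"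
      unfolding eventually_at_top_linorder by blast
    moreover have "((\<lambda>x. \<delta> * (1 - exp (- l * x))) \<longlongrightarrow> \<delta> * (1 - 0)) at_top"
      by (intro tendsto_intros tendsto_exp_decay \<open>0 < l\<close>)
    ultimately show ?thesis
      by (intro tendsto_upperbound) auto
  qed
  have "inj_on F {0<..\<epsilon>0}"
    by (intro inj_onI antisym; rule le) auto
  moreover have "infinite {0<..\<epsilon>0}" using \<open>0 < \<epsilon>0\<close> by (simp add: infinite_Ioc)
  ultimately have "infinite (F ` {0<..\<epsilon>0})" by (simp add: finite_image_iff)
  moreover have "F ` {0<..\<epsilon>0} \<subseteq> S" using member by auto
  ultimately show ?thesis using infinite_super by blast
qed

theorem theorem3p1:
  fixes h \<kappa>m \<kappa>p \<rho>hat \<rho>m \<rho>p fbar :: real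
    and \<kappa> v v' v'' w w' :: "real \<Rightarrow> real"
    and f\<^sub>\<rho> :: "real \<Rightarrow> real \<Rightarrow> real"
  assumes h_pos: "h > 0"
    and \<kappa>_pos: "\<kappa>m > 0" "\<kappa>p > 0"
    and \<kappa>_neg_side: "\<And>x. x < 0 \<Longrightarrow> \<kappa> x = \<kappa>m"
    and \<kappa>_pos_side: "\<And>x. x > 0 \<Longrightarrow> \<kappa> x = \<kappa>p"
    and v_deriv: "\<And>\<rho>. \<rho> \<in> {0..1} \<Longrightarrow> (v has_real_derivative v' \<rho>) (at \<rho> within {0..1})"
    and v_deriv2: "\<And>\<rho>. \<rho> \<in> {0..1} \<Longrightarrow> (v' has_real_derivative v'' \<rho>) (at \<rho> within {0..1})"
    and v_C2: "continuous_on {0..1} v''"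
    and v_ends: "v 0 = 1" "v 1 = 0"
    and v'_neg: "\<And>\<rho>. \<rho> \<in> {0..1} \<Longrightarrow> v' \<rho> < 0"
    and v''_nonpos: "\<And>\<rho>. \<rho> \<in> {0..1} \<Longrightarrow> v'' \<rho> \<le> 0"
    and w_nonneg: "\<And>x. x \<ge> 0 \<Longrightarrow> w x \<ge> 0"
    and w_cont: "continuous_on {0<..} w"
    and w_bounded: "bounded (w ` {0<..})"
    and w_integral: "(w has_integral 1) {0..h}"
    and w_zero: "\<And>x. x \<ge> h \<Longrightarrow> w x = 0"
    and w_deriv: "\<And>x. x \<in> {0<..<h} \<Longrightarrow> (w has_real_derivative w' x) (at x)"
    and w'_neg: "\<And>x. x \<in> {0<..<h} \<Longrightarrow> w' x < 0"
    and f_deriv: "\<And>k \<rho>. k > 0 \<Longrightarrow> \<rho> \<in> {0..1} \<Longrightarrow>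
        (local_flux v k has_real_derivative f\<^sub>\<rho> k \<rho>) (at \<rho> within {0..1})"
    and \<rho>hat_range: "\<rho>hat \<in> {0<..<1}"
    and \<rho>hat_crit: "\<And>k. k > 0 \<Longrightarrow> f\<^sub>\<rho> k \<rho>hat = 0"
    and \<rho>hat_left: "\<And>k \<rho>. k > 0 \<Longrightarrow> \<rho> \<in> {0..<\<rho>hat} \<Longrightarrow> f\<^sub>\<rho> k \<rho> > 0"
    and \<rho>hat_right: "\<And>k \<rho>. k > 0 \<Longrightarrow> \<rho> \<in> {\<rho>hat<..1} \<Longrightarrow> f\<^sub>\<rho> k \<rho> < 0"
    and \<kappa>_drop: "\<kappa>m > \<kappa>p"
    and densities: "0 < \<rho>m" "\<rho>m < \<rho>hat" "\<rho>hat < \<rho>p" "\<rho>p < 1"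
    and flux_left: "local_flux v \<kappa>m \<rho>m = fbar"
    and flux_right: "local_flux v \<kappa>p \<rho>p = fbar"
  shows "infinite (connecting_profiles \<kappa> v w h fbar \<rho>m \<rho>p) \<and>
    (\<forall>P \<in> connecting_profiles \<kappa> v w h fbar \<rho>m \<rho>p.
        isCont P 0 \<and> \<not> P differentiable (at 0))"
proof -
  \<comment> \<open>Extending the weight by zero, its value at \<open>0\<close> included, turns the integral over
      \<open>[x, x + h]\<close> into a convolution on the line.\<close>
  define W where "W s = (if 0 < s \<and> s < h then w s else 0)" for s
  \<comment> \<open>Clipping the argument to \<open>[0, 1]\<close> makes the velocity continuous and nonincreasing on the line.\<close>
  define V where "V r = v (max 0 (min 1 r))" for r
  obtain M where M: "\<And>s. 0 < s \<Longrightarrow> \<bar>w s\<bar> \<le> M" using w_bounded by (auto simp: bounded_iff)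
  have W_pos: "W s = w s" if "0 < s" for s using that w_zero by (auto simp: W_def)
  have w_less: "w t < w s" if "0 < s" "s < t" "t < h" for s t
  proof (rule DERIV_neg_imp_decreasing[OF that(2)])
    fix x assume "s \<le> x" "x \<le> t"
    with that have "x \<in> {0<..<h}" by simp
    then show "\<exists>y. (w has_real_derivative y) (at x) \<and> y < 0" using w_deriv w'_neg by blast
  qed
  have W_decreasing: "W t \<le> W s" if "0 < s" "s \<le> t" for s t
    using that w_less[of s t] w_nonneg[of s] by (cases "s = t") (auto simp: W_def)
  have W_measurable: "W \<in> borel_measurable borel"
  proof -
    have "W = (\<lambda>s. indicator {0<..<h} s *\<^sub>R w s)" by (auto simp: W_def indicator_def fun_eq_iff)
    moreover have "\<dots> \<in> borel_measurable borel"
      by (intro borel_measurable_continuous_on_indicator continuous_on_subset[OF w_cont]) auto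
    ultimately show ?thesis by simp
  qed
  have W_cont: "isCont W s" if "s \<noteq> 0" for s
  proof (cases "0 < s")
    case True
    have "continuous_on {0<..} W"
      using w_cont by (rule continuous_on_eq) (simp add: W_pos)
    then show ?thesis using True by (simp add: continuous_on_eq_continuous_at)
  next
    case False
    have "continuous_on {..<0} W"
      by (rule continuous_on_eq[of _ "\<lambda>_. 0"]) (auto simp: W_def)
    then show ?thesis using False that by (simp add: continuous_on_eq_continuous_at)
  qed
  interpret weight: look_ahead_weight W h M
  proof
    show "W s = 0" if "s \<le> 0 \<or> h \<le> s" for s using that by (auto simp: W_def)
    show "0 \<le> W s" for s using w_nonneg by (simp add: W_def)
    show "W s \<le> M" for s using M[of s] M[of h] h_pos by (auto simp: W_def)
  qed (use W_decreasing W_cont W_measurable h_pos in auto)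
  have mass: "(\<integral>s. W s \<partial>lborel) = 1"
  proof -
    have "(\<lambda>s. if s \<in> {0..h} then W s else 0) = W" by (auto simp: W_def fun_eq_iff)
    then have "(W has_integral (\<integral>s. W s \<partial>lborel)) {0..h}"
      using has_integral_integral_lborel[OF weight.W_integrable]
        has_integral_restrict_UNIV[of "{0..h}" W] by simp
    moreover have "(W has_integral 1) {0..h}"
      by (rule has_integral_spike_finite[OF _ _ w_integral, of "{0}"]) (auto simp: W_pos)
    ultimately show ?thesis by (rule has_integral_unique)
  qed
  have v_less: "v b < v a" if ab: "0 \<le> a" "a < b" "b \<le> 1" for a b
  proof -
    obtain x where "a < x" "x < b" "v b - v a = v' x * (b - a)"
      by (rule mean_value_within[of "{0..1}" v v' a b]) (use v_deriv ab in auto)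
    moreover from this have "v' x * (b - a) < 0"
      using v'_neg[of x] ab by (intro mult_neg_pos) auto
    ultimately show ?thesis by simp
  qed
  then have v_le: "v b \<le> v a" if "0 \<le> a" "a \<le> b" "b \<le> 1" for a b
    using that by (cases "a = b") (auto intro: less_imp_le)
  have V_eq: "V r = v r" if "0 \<le> r" "r \<le> 1" for r using that by (simp add: V_def)
  have road: "weighted_road W h M \<kappa>m \<kappa>p V"
  proof unfold_locales
    show "sets (weight_measure W) = sets borel" by (simp add: weight_measure_def)
    show "emeasure (weight_measure W) UNIV = 1"
      by (simp add: weight.emeasure_weight_measure mass)
    show "AE s in weight_measure W. 0 < s \<and> s < h" by (rule weight.AE_weight_measure)
    show "antimono V" unfolding V_def by (intro antimonoI v_le) auto
    have "continuous_on {0..1} v"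
      using DERIV_continuous[OF v_deriv] by (simp add: continuous_on_eq_continuous_within)
    then show "continuous_on UNIV V"
      unfolding V_def by (rule continuous_on_compose2) (auto intro!: continuous_intros)
    show "0 \<le> V r" "V r \<le> 1" for r
      using v_le[of "max 0 (min 1 r)" 1] v_le[of 0 "max 0 (min 1 r)"] v_ends by (auto simp: V_def)
  qed (use \<kappa>_pos \<kappa>_drop in auto)
  interpret weighted_road W h M \<kappa>m \<kappa>p V by (rule road)
  have flux: "nonlocal_flux \<kappa> v w h P x = P x * avg P x"
    if "P \<in> borel_measurable borel" "\<And>x. P x \<in> {0..1}" for P x
    using that by (intro flux_eq \<kappa>_neg_side \<kappa>_pos_side) (auto simp: V_eq W_pos)

  have fbar_pos: "0 < fbar"
    using flux_left \<kappa>_pos densities \<rho>hat_range v_less[of \<rho>m 1] v_ends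
    by (auto simp: local_flux_def)

  have corner: "isCont P 0 \<and> \<not> P differentiable (at 0)"
    if conn: "P \<in> connecting_profiles \<kappa> v w h fbar \<rho>m \<rho>p" for P
  proof -
    have range: "\<And>x. P x \<in> {0..1}" and bot: "(P \<longlongrightarrow> \<rho>m) at_bot" and top: "(P \<longlongrightarrow> \<rho>p) at_top"
      and monotone: "mono P \<or> antimono P" and P_flux: "\<And>x. nonlocal_flux \<kappa> v w h P x = fbar"
      using conn by (auto simp: connecting_profiles_def)
    have "\<not> antimono P"
    proof
      assume anti: "antimono P"
      have "P 0 \<le> \<rho>m"
        using bot by (rule tendsto_lowerbound)
          (auto simp: eventually_at_bot_linorder trivial_limit_at_bot_linorder intro!: exI[of _ 0] antimonoD[OF anti])
      moreover have "\<rho>p \<le> P 0"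
        using top by (rule tendsto_upperbound)
          (auto simp: eventually_at_top_linorder intro!: exI[of _ 0] antimonoD[OF anti])
      ultimately show False using densities by simp
    qed
    with monotone have "mono P" by simp
    then have meas: "P \<in> borel_measurable borel" by (rule mono_measurable)
    have eq: "P x * avg P x = fbar" for x using P_flux flux[OF meas range] by simp
    have "P 0 \<le> \<rho>p"
      using top by (rule tendsto_lowerbound)
        (auto simp: eventually_at_top_linorder intro!: exI[of _ 0] monoD[OF \<open>mono P\<close>])
    then have "0 < V (P 0)"
      using v_less[of "P 0" 1] range[of 0] densities v_ends by (simp add: V_eq)
    moreover have "0 < W (h / 2)"
      using h_pos w_less[of "h / 2" "3 * h / 4"] w_nonneg[of "3 * h / 4"] by (simp add: W_def)
    ultimately show ?thesis
      using isCont_profile[OF meas eq] profile_not_differentiable[OF \<open>mono P\<close> eq, of "h / 2"] fbar_pos h_pos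
      by simp
  qed

  \<comment> \<open>The flux on the left road exceeds \<open>fbar\<close> on \<open>(\<rho>m, \<rho>p]\<close>: it rises up to \<open>\<rho>hat\<close> and then falls,
      but at \<open>\<rho>p\<close> it is still \<open>\<kappa>m / \<kappa>p\<close> times \<open>fbar\<close>.\<close>
  have above: "fbar < \<kappa>m * r * V r" if r: "\<rho>m < r" "r \<le> \<rho>p" for r
  proof (cases "r \<le> \<rho>hat")
    case True
    obtain x where "\<rho>m < x" "x < r" "local_flux v \<kappa>m r - local_flux v \<kappa>m \<rho>m = f\<^sub>\<rho> \<kappa>m x * (r - \<rho>m)"
      by (rule mean_value_within[of "{0..1}" "local_flux v \<kappa>m" "f\<^sub>\<rho> \<kappa>m" \<rho>m r])
        (use f_deriv \<kappa>_pos r densities in auto)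
    moreover from this have "0 < f\<^sub>\<rho> \<kappa>m x * (r - \<rho>m)"
      using \<rho>hat_left[of \<kappa>m x] True r densities \<kappa>_pos by (intro mult_pos_pos) auto
    ultimately show ?thesis using flux_left r densities by (simp add: local_flux_def V_eq)
  next
    case False
    have "local_flux v \<kappa>m \<rho>p \<le> local_flux v \<kappa>m r"
    proof (cases "r = \<rho>p")
      case False
      with r have "r < \<rho>p" by simp
      obtain x where x: "r < x" "x < \<rho>p" "local_flux v \<kappa>m \<rho>p - local_flux v \<kappa>m r = f\<^sub>\<rho> \<kappa>m x * (\<rho>p - r)"
        by (rule mean_value_within[of "{0..1}" "local_flux v \<kappa>m" "f\<^sub>\<rho> \<kappa>m" r \<rho>p])
          (use f_deriv \<kappa>_pos r densities False in auto)
      then have "f\<^sub>\<rho> \<kappa>m x * (\<rho>p - r) < 0"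
        using \<rho>hat_right[of \<kappa>m x] \<open>\<not> r \<le> \<rho>hat\<close> \<open>r < \<rho>p\<close> densities \<kappa>_pos by (intro mult_neg_pos) auto
      with x show ?thesis by simp
    qed simp
    moreover have "fbar < local_flux v \<kappa>m \<rho>p"
      using flux_right \<kappa>_drop densities \<rho>hat_range v_less[of \<rho>p 1] v_ends
      by (auto simp: local_flux_def)
    ultimately show ?thesis using r densities by (simp add: local_flux_def V_eq)
  qed

  obtain K where K: "0 \<le> K"
    "\<And>r \<eta>. r \<le> 1 \<Longrightarrow> 0 \<le> \<eta> \<Longrightarrow> \<eta> \<le> r \<Longrightarrow> v (r - \<eta>) \<le> v r - v' r * \<eta>"
    "\<And>r \<eta>. r \<le> 1 \<Longrightarrow> 0 \<le> \<eta> \<Longrightarrow> \<eta> \<le> r \<Longrightarrow> v r - v' r * \<eta> - K * \<eta>\<^sup>2 \<le> v (r - \<eta>)"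
    using concave_tangent_parabola[OF v_deriv v_deriv2 v_C2 v''_nonpos] by blast
  define c where "c = - v' \<rho>p"
  have Vp: "0 < V \<rho>p" using v_less[of \<rho>p 1] densities \<rho>hat_range v_ends by (simp add: V_eq)
  \<comment> \<open>\<open>\<rho>p\<close> lies beyond the maximum of the flux, that is, \<open>v(\<rho>p) + \<rho>p v'(\<rho>p) < 0\<close>.\<close>
  have supercritical: "1 < \<rho>p * c / V \<rho>p"
  proof -
    have p: "0 < \<rho>p" "\<rho>p < 1" using densities by auto
    then have "(local_flux v 1 has_real_derivative f\<^sub>\<rho> 1 \<rho>p) (at \<rho>p)"
      using f_deriv[of 1 \<rho>p] by (simp add: at_within_Icc_at)
    moreover have "(v has_real_derivative v' \<rho>p) (at \<rho>p)"
      using v_deriv[of \<rho>p] p by (simp add: at_within_Icc_at)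
    then have "(local_flux v 1 has_real_derivative v \<rho>p + \<rho>p * v' \<rho>p) (at \<rho>p)"
      unfolding local_flux_def[abs_def] by (auto intro!: derivative_eq_intros)
    ultimately have "f\<^sub>\<rho> 1 \<rho>p = v \<rho>p + \<rho>p * v' \<rho>p" by (rule DERIV_unique)
    then have "v \<rho>p + \<rho>p * v' \<rho>p < 0" using \<rho>hat_right[of 1 \<rho>p] densities by simp
    then have "V \<rho>p < \<rho>p * c" using p by (simp add: c_def V_eq)
    then show ?thesis using Vp by (simp add: pos_less_divide_eq)
  qed
  obtain l where l: "0 < l" "\<rho>p * c / V \<rho>p * (\<integral>s. exp (- l * s) \<partial>weight_measure W) = 1"
    "\<rho>p * c / V \<rho>p * (\<integral>s. exp (- (2 * l) * s) \<partial>weight_measure W) < 1"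
    using decay_rate[OF supercritical] by blast
  define gap where "gap = V \<rho>p - \<rho>p * (c * (\<integral>s. exp (- (2 * l) * s) \<partial>weight_measure W))"
  have gap: "0 < gap" using l(3) Vp by (simp add: gap_def field_simps)
  define N where "N = \<rho>p * K + V \<rho>p / \<rho>p"
  have N: "0 < N" using K(1) Vp densities \<rho>hat_range by (auto simp: N_def intro!: add_nonneg_pos)
  define \<epsilon>0 where "\<epsilon>0 = min (\<rho>p - \<rho>m) (gap / N)"
  have \<epsilon>0: "0 < \<epsilon>0" using gap N densities by (simp add: \<epsilon>0_def)
  have "\<exists>F. F \<in> connecting_profiles \<kappa> v w h fbar \<rho>m \<rho>p \<and>
      (\<forall>x\<ge>0. \<rho>p - \<epsilon> * exp (- l * x) \<le> F x \<and>
        F x \<le> \<rho>p - (\<epsilon> * exp (- l * x) - \<epsilon> * exp (- (2 * l) * x)))"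
    if \<epsilon>: "0 < \<epsilon>" "\<epsilon> \<le> \<epsilon>0" for \<epsilon>
  proof -
    have small: "\<epsilon> \<le> \<rho>p - \<rho>m" "\<epsilon> * N \<le> gap"
      using \<epsilon> N by (auto simp: \<epsilon>0_def pos_le_divide_eq)
    obtain F where F: "mono F" "\<And>x. \<rho>m \<le> F x" "\<And>x. F x \<le> \<rho>p" "\<And>x. F x * avg F x = fbar"
      "(F \<longlongrightarrow> \<rho>m) at_bot"
      "\<And>x. 0 \<le> x \<Longrightarrow> \<rho>p - \<epsilon> * exp (- l * x) \<le> F x"
      "\<And>x. 0 \<le> x \<Longrightarrow> F x \<le> \<rho>p - (\<epsilon> * exp (- l * x) - \<epsilon> * exp (- (2 * l) * x))"
    proof (rule connecting_profile_with_tail[of \<rho>m \<rho>p fbar c K l \<epsilon>])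
      show "\<kappa>m * \<rho>m * V \<rho>m = fbar" "\<kappa>p * \<rho>p * V \<rho>p = fbar"
        using flux_left flux_right densities by (auto simp: local_flux_def V_eq)
      show "\<rho>p * c * (\<integral>s. exp (- l * s) \<partial>weight_measure W) = V \<rho>p"
        using l(2) Vp by (simp add: field_simps)
      show "V (\<rho>p - \<eta>) \<le> V \<rho>p + c * \<eta>" "V \<rho>p + c * \<eta> - K * \<eta>\<^sup>2 \<le> V (\<rho>p - \<eta>)"
        if "0 \<le> \<eta>" "\<eta> \<le> \<rho>p - \<rho>m" for \<eta>
        using K(2)[of \<rho>p \<eta>] K(3)[of \<rho>p \<eta>] that densities by (auto simp: V_eq c_def)
      show "0 \<le> c" using v'_neg[of \<rho>p] densities \<rho>hat_range by (simp add: c_def)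
      show "\<epsilon> * (\<rho>p * K + V \<rho>p / \<rho>p) \<le> V \<rho>p - \<rho>p * (c * (\<integral>s. exp (- (2 * l) * s) \<partial>weight_measure W))"
        using small(2) by (simp add: N_def gap_def)
    qed (use densities fbar_pos above K(1) l(1) \<epsilon> small in auto)
    have range: "F x \<in> {0..1}" for x using F(2)[of x] F(3)[of x] densities by simp
    have eq: "nonlocal_flux \<kappa> v w h F x = fbar" for x
      using flux[OF mono_measurable[OF F(1)] range] F(4) by simp
    then have "nonlocal_flux \<kappa> v w h F = (\<lambda>_. fbar)" by (simp add: fun_eq_iff)
    then have "stationary_profile \<kappa> v w h F"
      by (auto simp: stationary_profile_def solves_nonlocal_law_def intro!: exI[of _ 0])
    moreover have "(F \<longlongrightarrow> \<rho>p) at_top"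
    proof (rule tendsto_sandwich)
      show "\<forall>\<^sub>F x in at_top. \<rho>p - \<epsilon> * exp (- l * x) \<le> F x"
        unfolding eventually_at_top_linorder using F(6) by blast
      show "\<forall>\<^sub>F x in at_top. F x \<le> \<rho>p" using F(3) by simp
      show "((\<lambda>x. \<rho>p - \<epsilon> * exp (- l * x)) \<longlongrightarrow> \<rho>p) at_top"
        using tendsto_diff[OF tendsto_const tendsto_mult_right_zero[OF tendsto_exp_decay[OF l(1)]]] by simp
    qed simp
    ultimately have "F \<in> connecting_profiles \<kappa> v w h fbar \<rho>m \<rho>p"
      using F range eq by (simp add: connecting_profiles_def)
    then show ?thesis using F(6,7) by blast
  qed
  then obtain F where F: "\<And>\<epsilon>. 0 < \<epsilon> \<Longrightarrow> \<epsilon> \<le> \<epsilon>0 \<Longrightarrow>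
      F \<epsilon> \<in> connecting_profiles \<kappa> v w h fbar \<rho>m \<rho>p \<and>
      (\<forall>x\<ge>0. \<rho>p - \<epsilon> * exp (- l * x) \<le> F \<epsilon> x \<and>
        F \<epsilon> x \<le> \<rho>p - (\<epsilon> * exp (- l * x) - \<epsilon> * exp (- (2 * l) * x)))"
    by metis
  have "infinite (connecting_profiles \<kappa> v w h fbar \<rho>m \<rho>p)"
    by (rule infinite_by_tail_coefficient[OF \<epsilon>0 l(1), where F = F]) (use F in blast)+
  with corner show ?thesis by blast
qed

end
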